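(* Let $\mathbf{A}=[\mathbf{a}_1\ \cdots\ \mathbf{a}_m]\in\mathbb{R}^{n\times m}$ with $m\ge n$ be such that (i) no column of $\mathbf{A}$ is the zero vector and (ii) no two (distinct-index) columns of $\mathbf{A}$ are scalar multiples of each other. Let $Z(\mathbf{A})=\{\mathbf{A}\mathbf{x}\mid \mathbf{x}\in[-1,1]^m\}$. For every $\mathbf{x}\in\mathbb{R}^n$ such that all components of $\mathbf{A}^T\mathbf{x}$ are nonzero, the point $$\mathbf{v}=\mathbf{m}(\mathbf{x}):=\mathbf{A}\,\operatorname{sign}(\mathbf{A}^T\mathbf{x})$$ is a vertex of the zonotope $Z(\mathbf{A})$.
   Context: For a vector $\mathbf{w}$ with all entries nonzero, $\operatorname{sign}(\mathbf{w})$ is the vector with entries in $\{-1,1\}$ giving the signs of the components of $\mathbf{w}$. A vertex of a polytope is an extreme point of it. *)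

theory Defs
  imports "HOL-Analysis.Analysis"
begin

definition zonotope :: "real ^ 'm ^ 'n \<Rightarrow> (real ^ 'n) set" where
  "zonotope A = {A *v x | x. \<forall>j. x $ j \<in> {-1..1}}"

(* Only meaningful for vectors without zero entries, where every entry is -1 or 1;
   sgn sends a zero entry to 0. *)
definition sign_vec :: "real ^ 'k \<Rightarrow> real ^ 'k" where
  "sign_vec w = (\<chi> j. sgn (w $ j))"

definition zonotope_map :: "real ^ 'm ^ 'n \<Rightarrow> real ^ 'n \<Rightarrow> real ^ 'n" where
  "zonotope_map A x = A *v sign_vec (transpose A *v x)"

end

theory Submission
  imports Defs
begin

text \<open>
  Among all points of the zonotope, \<open>A *v sign_vec (transpose A *v x)\<close> is the only one at which the
  linear functional \<open>z \<mapsto> x \<bullet> z\<close> is largest, and the unique maximizer of a linear functional over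
  any set is an extreme point of it (\<open>unique_maximizer_extreme_point\<close>). For the maximization, write
  a point of the zonotope as \<open>A *v y\<close> with \<open>y\<close> in the cube and put \<open>w = transpose A *v x\<close>. Then
  \<open>x \<bullet> (A *v y) = w \<bullet> y\<close> is a sum of the independent terms \<open>w $ j * y $ j\<close>. As \<open>w $ j \<noteq> 0\<close>, the
  term with index \<open>j\<close> is largest exactly for \<open>y $ j = sgn (w $ j)\<close>, so \<open>sign_vec w\<close> is the unique
  maximizer over the cube (\<open>inner_less_inner_sign_vec\<close>).
\<close>

text \<open>
  A point strictly between \<open>a\<close> and \<open>b\<close> has as its value a weighted average of the values at \<open>a\<close> and
  \<open>b\<close>, which cannot exceed both of them.
\<close>

lemma unique_maximizer_extreme_point:
  fixes c v :: "'a::real_inner"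
  assumes "v \<in> S" and max: "\<And>z. \<lbrakk>z \<in> S; z \<noteq> v\<rbrakk> \<Longrightarrow> c \<bullet> z < c \<bullet> v"
  shows "v extreme_point_of S"
  unfolding extreme_point_of_def
proof (intro conjI ballI notI)
  show "v \<in> S" by fact
next
  fix a b assume ab: "a \<in> S" "b \<in> S" and seg: "v \<in> open_segment a b"
  obtain u where u: "0 < u" "u < 1" "v = (1 - u) *\<^sub>R a + u *\<^sub>R b"
    using seg by (auto simp: in_segment)
  have "a \<noteq> v" "b \<noteq> v"
    using seg by (auto simp: open_segment_def)
  then have "c \<bullet> a < c \<bullet> v" "c \<bullet> b < c \<bullet> v"
    using max ab by auto
  then have "(1 - u) * (c \<bullet> a) + u * (c \<bullet> b) < (1 - u) * (c \<bullet> v) + u * (c \<bullet> v)"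
    using u(1,2) by (intro add_strict_mono mult_strict_left_mono) auto
  moreover have "c \<bullet> v = (1 - u) * (c \<bullet> a) + u * (c \<bullet> b)"
    by (subst u(3)) (simp add: inner_add_right)
  ultimately show False
    by (simp add: algebra_simps)
qed

lemma inner_less_inner_sign_vec:
  fixes w y :: "real ^ 'k"
  assumes w: "\<And>j. w $ j \<noteq> 0" and y: "\<And>j. \<bar>y $ j\<bar> \<le> 1" and "y \<noteq> sign_vec w"
  shows "w \<bullet> y < w \<bullet> sign_vec w"
proof -
  have le: "w $ j * y $ j \<le> w $ j * sgn (w $ j)" for j
  proof -
    have "w $ j * y $ j \<le> \<bar>w $ j\<bar> * \<bar>y $ j\<bar>"
      by (metis abs_ge_self abs_mult)
    also have "\<dots> \<le> \<bar>w $ j\<bar>"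
      using y[of j] by (simp add: mult_left_le)
    finally show ?thesis
      by (simp add: linordered_idom_class.abs_sgn)
  qed
  obtain i where i: "y $ i \<noteq> sgn (w $ i)"
    using \<open>y \<noteq> sign_vec w\<close> by (auto simp: sign_vec_def vec_eq_iff)
  have "w $ i * y $ i \<noteq> w $ i * sgn (w $ i)"
    using i w[of i] by simp
  with le[of i] have "w $ i * y $ i < w $ i * sgn (w $ i)"
    by (rule order.not_eq_order_implies_strict[rotated])
  then show ?thesis
    unfolding inner_vec_def sign_vec_def
    using le by (auto intro!: sum_strict_mono_ex1)
qed

theorem theorem2:
  fixes A :: "real ^ 'm ^ 'n" and x :: "real ^ 'n"
  assumes "CARD('m) \<ge> CARD('n)"
    and "\<forall>j. column j A \<noteq> 0"
    and "\<forall>j k. j \<noteq> k \<longrightarrow> \<not> (\<exists>c::real. column j A = c *\<^sub>R column k A)"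
    and "\<forall>j. (transpose A *v x) $ j \<noteq> 0"
  shows "zonotope_map A x extreme_point_of zonotope A"
proof (rule unique_maximizer_extreme_point)
  have "sign_vec (transpose A *v x) $ j \<in> {-1..1}" for j
    by (simp add: sign_vec_def sgn_if)
  then show "zonotope_map A x \<in> zonotope A"
    unfolding zonotope_map_def zonotope_def by blast
next
  fix z assume z: "z \<in> zonotope A" and ne: "z \<noteq> zonotope_map A x"
  obtain y where y: "z = A *v y" "\<And>j. \<bar>y $ j\<bar> \<le> 1"
    using z by (auto simp: zonotope_def abs_le_iff minus_le_iff)
  have "y \<noteq> sign_vec (transpose A *v x)"
    using ne y(1) by (auto simp: zonotope_map_def)
  then have "(transpose A *v x) \<bullet> y < (transpose A *v x) \<bullet> sign_vec (transpose A *v x)"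
    using assms(4) y(2) by (intro inner_less_inner_sign_vec) auto
  then show "x \<bullet> z < x \<bullet> zonotope_map A x"
    by (simp add: y(1) zonotope_map_def dot_lmul_matrix)
qed

end
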